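(* Let $(x_n)$ be generated by (HPPA). Assume there are monotone functions ${\rm a},{\rm b},{\rm B},{\rm E}:\mathbb{N}\to\mathbb{N}$ satisfying (Q1), (Q3'), (Q3), (Q4) respectively, and a function ${\rm A'}:\mathbb{N}\times\mathbb{N}\to\mathbb{N}$, monotone in both variables, satisfying (Q2'). Let $\mathcal{E},\mathcal{D}\in\mathbb{N}$ satisfy $\mathcal{E}\geq 1+\sum_{i=0}^{{\rm E}(0)}\|e_i\|$ and $\mathcal{D}\geq\|x_0-p\|$ for some $p\in S$, and set $N:=\max\{2\mathcal{D},\mathcal{D}+\mathcal{E}\}$. Then for every $k\in\mathbb{N}$ and every monotone $f:\mathbb{N}\to\mathbb{N}$, $$\exists n\leq\Phi_2(k,f)\ \forall i,j\in[n,f(n)]\ \left(\|x_i-x_j\|\leq\frac{1}{k+1}\right),$$ where $\Phi_2(k,f):=\sigma_2(\tilde k,g(\Delta))$ and: $\sigma_2(k',n'):={\rm A'}\big(n',\,16N^2(k'+1)-1\big)+1$; $\tilde k:=4(k+1)^2-1$; $g(m):=\max\{m,\ {\rm E}(16(1+4N)(k+1)^2-1)+1\}$; $\bar h_f(m):=(1+4N)\big(16(k+1)^2(f(\sigma_2(\tilde k,g(m)))+1)+1\big)-1$; $\Delta:=\Psi(32(k+1)^2-1,\,\bar h_f)$, where for $k'\in\mathbb{N}$ and monotone $u:\mathbb{N}\to\mathbb{N}$, $\Psi(k',u):=\chi_1\big(24N(w_{\hat\nu_u,N}^{(R)}(0)+1)^2\big)$ with $R:=4N^4(k'+1)^2$,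 $\nu_u(m):=\max\{2,{\rm b}(u(m))\}(u(m)+1)-1$, $\hat\nu_u(m):=\nu_u(\chi_1(m))$, $w_{v,N}(m):=\max\{v(24N(m+1)^2),24N(m+1)^2\}$, $\xi(k''):=\max\{{\rm a}(2(2\mathcal{D}+\mathcal{E})(k''+1)-1),{\rm E}(2k''+1)+1\}$ and $\chi_1(k''):=\max\{\xi(4k''+3),{\rm B}(8(\mathcal{D}+\mathcal{E})(k''+1)-1)\}+1$.
   Context: $X$ is a real Hilbert space, $\mathsf{A}:X\to 2^X$ a maximal monotone operator with zero set $S=\{x:0\in\mathsf{A}(x)\}$, assumed nonempty. For $\beta>0$, $J_\beta:=(Id+\beta\mathsf{A})^{-1}$ is the resolvent, a single-valued nonexpansive map with fixed point set $S$. Given $(\alpha_n)\subset\,]0,1[$, $(\beta_n)\subset(0,\infty)$, $(e_n)\subset X$, $x_0\in X$, (HPPA) is the sequence $x_{n+1}:=\alpha_n x_0+(1-\alpha_n)(J_{\beta_n}(x_n)+e_n)$. (Q1): $\forall k\,\forall n\geq{\rm a}(k)\ \alpha_n\leq\frac{1}{k+1}$. (Q2'): $\forall k,m\ \prod_{i=m}^{{\rm A'}(m,k)}(1-\alpha_i)\leq\frac{1}{k+1}$. ${\rm A'}$ monotone in both variables: $k\le k'$, $m\le m'$ imply ${\rm A'}(m,k)\le{\rm A'}(m',k')$. (Q3'): $\forall n\ \beta_n\leq{\rm b}(n)$. (Q3): $\forall k\,\forall n\geq{\rm B}(k)\ \beta_n\geq k$. (Q4): $\forall k\,\forall n\ \sum_{i={\rm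 E}(k)+1}^{{\rm E}(k)+n}\|e_i\|\leq\frac{1}{k+1}$. Monotone means nondecreasing. $v^{(R)}$ is the $R$-fold composition of $v$ ($v^{(0)}$ the identity). $[a,b]$ is the set of naturals $m$ with $a\le m\le b$. *)

theory Defs
  imports "HOL-Analysis.Analysis"
begin

definition monotone_op :: "('a::real_inner \<Rightarrow> 'a set) \<Rightarrow> bool" where
  "monotone_op A \<longleftrightarrow> (\<forall>x y u v. u \<in> A x \<longrightarrow> v \<in> A y \<longrightarrow> inner (x - y) (u - v) \<ge> 0)"

definition maximal_monotone :: "('a::real_inner \<Rightarrow> 'a set) \<Rightarrow> bool" where
  "maximal_monotone A \<longleftrightarrow> monotone_op A \<and>
     (\<forall>B. monotone_op B \<and> (\<forall>x. A x \<subseteq> B x) \<longrightarrow> B = A)"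

definition zeros_op :: "('a::real_inner \<Rightarrow> 'a set) \<Rightarrow> 'a set" where
  "zeros_op A = {x. 0 \<in> A x}"

definition resolvent :: "('a::real_inner \<Rightarrow> 'a set) \<Rightarrow> real \<Rightarrow> 'a \<Rightarrow> 'a" where
  "resolvent A \<beta> x = (THE y. \<exists>u \<in> A y. x = y + \<beta> *\<^sub>R u)"

definition sigma2 :: "(nat \<Rightarrow> nat \<Rightarrow> nat) \<Rightarrow> nat \<Rightarrow> nat \<Rightarrow> nat \<Rightarrow> nat" where
  "sigma2 A' N k' n' = A' n' (16 * N^2 * (k' + 1) - 1) + 1"

definition xi_rate :: "(nat \<Rightarrow> nat) \<Rightarrow> (nat \<Rightarrow> nat) \<Rightarrow> nat \<Rightarrow> nat \<Rightarrow> nat \<Rightarrow> nat" where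
  "xi_rate a E D Ec k'' = max (a (2 * (2 * D + Ec) * (k'' + 1) - 1)) (E (2 * k'' + 1) + 1)"

definition chi1 :: "(nat \<Rightarrow> nat) \<Rightarrow> (nat \<Rightarrow> nat) \<Rightarrow> (nat \<Rightarrow> nat) \<Rightarrow> nat \<Rightarrow> nat \<Rightarrow> nat \<Rightarrow> nat" where
  "chi1 a B E D Ec k'' = max (xi_rate a E D Ec (4 * k'' + 3)) (B (8 * (D + Ec) * (k'' + 1) - 1)) + 1"

definition nu_rate :: "(nat \<Rightarrow> nat) \<Rightarrow> (nat \<Rightarrow> nat) \<Rightarrow> nat \<Rightarrow> nat" where
  "nu_rate b u m = max 2 (b (u m)) * (u m + 1) - 1"

definition w_rate :: "(nat \<Rightarrow> nat) \<Rightarrow> nat \<Rightarrow> nat \<Rightarrow> nat" where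
  "w_rate v N m = max (v (24 * N * (m + 1)^2)) (24 * N * (m + 1)^2)"

definition Psi_rate :: "(nat \<Rightarrow> nat) \<Rightarrow> (nat \<Rightarrow> nat) \<Rightarrow> (nat \<Rightarrow> nat) \<Rightarrow> (nat \<Rightarrow> nat)
    \<Rightarrow> nat \<Rightarrow> nat \<Rightarrow> nat \<Rightarrow> nat \<Rightarrow> (nat \<Rightarrow> nat) \<Rightarrow> nat" where
  "Psi_rate a b B E D Ec N k' u =
     (let R = 4 * N^4 * (k' + 1)^2;
          nuhat = (\<lambda>m. nu_rate b u (chi1 a B E D Ec m))
      in chi1 a B E D Ec (24 * N * (((w_rate nuhat N) ^^ R) 0 + 1)^2))"

definition Phi2 :: "(nat \<Rightarrow> nat) \<Rightarrow> (nat \<Rightarrow> nat \<Rightarrow> nat) \<Rightarrow> (nat \<Rightarrow> nat) \<Rightarrow> (nat \<Rightarrow> nat) \<Rightarrow> (nat \<Rightarrow> nat)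
    \<Rightarrow> nat \<Rightarrow> nat \<Rightarrow> nat \<Rightarrow> (nat \<Rightarrow> nat) \<Rightarrow> nat" where
  "Phi2 a A' b B E D Ec k f =
     (let N = max (2 * D) (D + Ec);
          kt = 4 * (k + 1)^2 - 1;
          g = (\<lambda>m. max m (E (16 * (1 + 4 * N) * (k + 1)^2 - 1) + 1));
          hbar = (\<lambda>m. (1 + 4 * N) * (16 * (k + 1)^2 * (f (sigma2 A' N kt (g m)) + 1) + 1) - 1);
          \<Delta> = Psi_rate a b B E D Ec N (32 * (k + 1)^2 - 1) hbar
      in sigma2 A' N kt (g \<Delta>))"

end

theory Submission
  imports Defs
begin

text \<open>For an approximate projection \<open>z\<close> of \<open>x 0\<close> onto the zero set, Xu's recursion for
  \<open>\<parallel>x n - z\<parallel>\<^sup>2\<close> makes \<open>x\<close> stay near \<open>z\<close> on a whole interval, provided \<open>z\<close> is moved little by the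
  resolvents and \<open>\<langle>x 0 - z, x m - z\<rangle>\<close> is small for late \<open>m\<close>. The weak compactness argument that
  classically gives the second condition is replaced by a finite descent of \<open>\<parallel>z - x 0\<parallel>\<^sup>2\<close> along
  approximate fixed points of the resolvent of parameter 1; since the step sizes are unbounded, the
  iterates are eventually such approximate fixed points. \<open>Q3'\<close> transfers the fixed point error from
  parameter 1 to the finitely many resolvents used on the interval.\<close>

section \<open>Minty's theorem and resolvents\<close>

lemma maximal_monotoneD_monotone:
  assumes "maximal_monotone A" "u \<in> A x" "v \<in> A y"
  shows "inner (x - y) (u - v) \<ge> 0"
  using assms unfolding maximal_monotone_def monotone_op_def by blast

text \<open>Inserting \<open>u\<close> into \<open>A x\<close> keeps the operator monotone, so by
  maximality the insertion changes nothing.\<close>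

lemma maximal_monotone_memI:
  assumes max: "maximal_monotone A"
    and rel: "\<And>y v. v \<in> A y \<Longrightarrow> inner (x - y) (u - v) \<ge> 0"
  shows "u \<in> A x"
proof -
  define B where "B = A(x := insert u (A x))"
  have "inner (y - z) (v - w) \<ge> 0" if "v \<in> B y" "w \<in> B z" for y z v w
  proof -
    have "v \<in> A y \<or> y = x \<and> v = u" "w \<in> A z \<or> z = x \<and> w = u"
      using that by (auto simp: B_def split: if_splits)
    moreover have "inner (y - x) (v - u) = inner (x - y) (u - v)"
      by (simp add: inner_diff_left inner_diff_right)
    ultimately show ?thesis
      using rel[of w z] rel[of v y] maximal_monotoneD_monotone[OF max, of v y w z] by auto
  qed
  then have "monotone_op B"
    unfolding monotone_op_def by blast
  moreover have "\<forall>y. A y \<subseteq> B y"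
    by (auto simp: B_def)
  ultimately have "B = A"
    using max unfolding maximal_monotone_def by blast
  then show ?thesis
    unfolding B_def by (metis fun_upd_same insertI1)
qed

lemma norm_convex_combination_sq:
  fixes x y :: "'a::real_inner"
  shows "(norm ((1 - t) *\<^sub>R x + t *\<^sub>R y))\<^sup>2
    = (1 - t) * (norm x)\<^sup>2 + t * (norm y)\<^sup>2 - t * (1 - t) * (norm (x - y))\<^sup>2"
  unfolding power2_norm_eq_inner
  by (simp add: inner_diff_left inner_diff_right inner_add_left inner_add_right inner_commute algebra_simps)

text \<open>The Fitzpatrick function \<open>F (x, u) = sup {\<langle>x, v\<rangle> + \<langle>y, u\<rangle> - \<langle>y, v\<rangle> | v \<in> A y}\<close> dominates
  the duality product by maximality, so \<open>F + \<parallel>\<cdot>\<parallel>\<^sup>2 / 2\<close> is nonnegative, lower semicontinuous and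
  strongly convex. It attains its minimum at some \<open>(x\<^sub>0, u\<^sub>0)\<close>, and the first-order condition there makes
  \<open>(-u\<^sub>0, -x\<^sub>0)\<close> monotonically related to the graph and forces \<open>u\<^sub>0 = -x\<^sub>0\<close>.
  Below, \<open>Q r z\<close> says that this function is at most \<open>r\<close> at \<open>z\<close>.\<close>

lemma minty_zero:
  fixes A :: "'a::{real_inner, complete_space} \<Rightarrow> 'a set"
  assumes mon: "\<And>x y u v. u \<in> A x \<Longrightarrow> v \<in> A y \<Longrightarrow> inner (x - y) (u - v) \<ge> 0"
    and max: "\<And>x u. (\<And>y v. v \<in> A y \<Longrightarrow> inner (x - y) (u - v) \<ge> 0) \<Longrightarrow> u \<in> A x"
  shows "\<exists>x. - x \<in> A x"
proof -
  define Q where "Q r z \<longleftrightarrow> (\<forall>y v. v \<in> A y \<longrightarrow>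
      inner (fst z) v + inner y (snd z) - inner y v + (norm z)\<^sup>2 / 2 \<le> r)" for r and z :: "'a \<times> 'a"
  have Q_mono: "Q s z" if "Q r z" "r \<le> s" for r s z
    using that unfolding Q_def by (meson order_trans)
  have Q_nonneg: "r \<ge> 0" if "Q r z" for r z
  proof -
    obtain x u where z: "z = (x, u)" by force
    \<comment> \<open>Some graph point makes the pairing nonpositive: \<open>(x, u)\<close> itself
      if it lies in the graph, otherwise a violation supplied by \<open>max\<close>. What then
      remains below \<open>r\<close> is half the square of \<open>norm (x + u)\<close>.\<close>
    obtain y v where yv: "v \<in> A y" "inner (x - y) (u - v) \<le> 0"
    proof (cases "u \<in> A x")
      case True
      then show ?thesis using that[of u x] by simp
    next
      case False
      then show ?thesis using max[of x u] that by force
    qed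
    have "inner x v + inner y u - inner y v + (norm z)\<^sup>2 / 2 \<le> r"
      using that yv(1) by (auto simp: Q_def z)
    moreover have "inner (x - y) (u - v) = inner x u - inner x v - inner y u + inner y v"
      by (simp add: inner_diff_left inner_diff_right)
    ultimately have "inner x u + (norm z)\<^sup>2 / 2 \<le> r"
      using yv(2) by linarith
    moreover have "2 * inner x u + (norm z)\<^sup>2 = (norm (x + u))\<^sup>2"
      unfolding power2_norm_eq_inner z
      by (simp add: inner_prod_def inner_add_left inner_add_right inner_commute)
    ultimately show ?thesis
      using zero_le_power2[of "norm (x + u)"] by linarith
  qed
  \<comment> \<open>The part \<open>?l\<close> is affine in \<open>z\<close>, so the strong
    convexity comes entirely from the quadratic term.\<close>
  have Q_convex: "Q ((1 - t) * r + t * s - t * (1 - t) / 2 * (norm (z - z'))\<^sup>2) ((1 - t) *\<^sub>R z + t *\<^sub>R z')"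
    if Q: "Q r z" "Q s z'" and t: "0 \<le> t" "t \<le> 1" for r s t z z'
    unfolding Q_def
  proof (intro allI impI)
    fix y v assume yv: "v \<in> A y"
    let ?w = "(1 - t) *\<^sub>R z + t *\<^sub>R z'"
    let ?l = "\<lambda>z. inner (fst z) v + inner y (snd z) - inner y v"
    have "?l ?w = (1 - t) * ?l z + t * ?l z'"
      by (simp add: inner_add_left inner_add_right algebra_simps)
    moreover have "(norm ?w)\<^sup>2 / 2
        = (1 - t) * ((norm z)\<^sup>2 / 2) + t * ((norm z')\<^sup>2 / 2) - t * (1 - t) / 2 * (norm (z - z'))\<^sup>2"
      unfolding norm_convex_combination_sq by (simp add: field_simps)
    moreover have "(1 - t) * a + t * b + ((1 - t) * c + t * d - q) = (1 - t) * (a + c) + t * (b + d) - q"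
      for a b c d q
      by (simp add: algebra_simps)
    ultimately have "?l ?w + (norm ?w)\<^sup>2 / 2 = (1 - t) * (?l z + (norm z)\<^sup>2 / 2)
        + t * (?l z' + (norm z')\<^sup>2 / 2) - t * (1 - t) / 2 * (norm (z - z'))\<^sup>2"
      by (simp only:)
    also have "\<dots> \<le> (1 - t) * r + t * s - t * (1 - t) / 2 * (norm (z - z'))\<^sup>2"
      using Q yv t by (intro diff_mono add_mono mult_left_mono order_refl) (auto simp: Q_def)
    finally show "?l ?w + (norm ?w)\<^sup>2 / 2 \<le> (1 - t) * r + t * s - t * (1 - t) / 2 * (norm (z - z'))\<^sup>2" .
  qed
  have Q_graph: "Q (inner y v + (norm (y, v))\<^sup>2 / 2) (y, v)" if "v \<in> A y" for y v
    unfolding Q_def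
  proof (intro allI impI)
    fix y' v' assume "v' \<in> A y'"
    then have "0 \<le> inner (y - y') (v - v')"
      using that by (intro mon)
    then show "inner (fst (y, v)) v' + inner y' (snd (y, v)) - inner y' v' + (norm (y, v))\<^sup>2 / 2
        \<le> inner y v + (norm (y, v))\<^sup>2 / 2"
      by (simp add: inner_diff_left inner_diff_right)
  qed
  \<comment> \<open>If the graph were empty, the premise of \<open>max\<close> would hold vacuously
    and put \<open>0\<close> into \<open>A 0\<close>.\<close>
  obtain y0 v0 where "v0 \<in> A y0"
    using max[of 0 0] by auto
  define M where "M = {r. \<exists>z. Q r z}"
  have M_ne: "M \<noteq> {}"
    using Q_graph[OF \<open>v0 \<in> A y0\<close>] by (auto simp: M_def)
  have M_bdd: "bdd_below M"
    using Q_nonneg by (auto simp: M_def bdd_below_def)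
  define m where "m = Inf M"
  have m_le: "m \<le> r" if "Q r z" for r z
    unfolding m_def using that M_bdd unfolding M_def by (intro cInf_lower CollectI exI)
  have m_nonneg: "0 \<le> m"
    unfolding m_def using M_ne Q_nonneg by (intro cInf_greatest) (auto simp: M_def)
  have "\<exists>z. Q (m + inverse (real (Suc n))) z" for n
  proof -
    obtain r where "r \<in> M" "r < m + inverse (real (Suc n))"
      using cInf_lessD[OF M_ne, of "m + inverse (real (Suc n))"] by (auto simp: m_def)
    then show ?thesis
      unfolding M_def using Q_mono less_imp_le by fast
  qed
  then obtain z where z: "\<And>n. Q (m + inverse (real (Suc n))) (z n)"
    by metis
  \<comment> \<open>The midpoint value is at least \<open>m\<close>, so an eighth of the squared
    distance is at most the mean excess over \<open>m\<close>; minimizing sequences are therefore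
    Cauchy.\<close>
  have z_diff: "(norm (z i - z j))\<^sup>2 \<le> 4 * (inverse (real (Suc i)) + inverse (real (Suc j)))" for i j
    using m_le[OF Q_convex[OF z[of i] z[of j], of "1 / 2"]] by simp argo
  have "Cauchy z"
  proof (rule CauchyI)
    fix \<epsilon> :: real assume "0 < \<epsilon>"
    then obtain K where K: "inverse (real (Suc K)) < \<epsilon>\<^sup>2 / 8"
      using reals_Archimedean[of "\<epsilon>\<^sup>2 / 8"] by auto
    have "norm (z i - z j) < \<epsilon>" if "i \<ge> K" "j \<ge> K" for i j
    proof -
      have "inverse (real (Suc i)) \<le> inverse (real (Suc K))" "inverse (real (Suc j)) \<le> inverse (real (Suc K))"
        using that by auto
      then have "(norm (z i - z j))\<^sup>2 < \<epsilon>\<^sup>2"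
        using z_diff[of i j] K by argo
      then show ?thesis
        using \<open>0 < \<epsilon>\<close> by (simp add: power_less_imp_less_base)
    qed
    then show "\<exists>K. \<forall>i\<ge>K. \<forall>j\<ge>K. norm (z i - z j) < \<epsilon>" by blast
  qed
  then obtain z0 where lim: "z \<longlonglongrightarrow> z0"
    using Cauchy_convergent convergent_def by blast
  have Qm: "Q m z0"
    unfolding Q_def
  proof (intro allI impI)
    fix y v assume yv: "v \<in> A y"
    have "(\<lambda>n. m + inverse (real (Suc n))) \<longlonglongrightarrow> m + 0"
      by (intro tendsto_intros LIMSEQ_inverse_real_of_nat)
    moreover have "(\<lambda>n. inner (fst (z n)) v + inner y (snd (z n)) - inner y v + (norm (z n))\<^sup>2 / 2)
        \<longlonglongrightarrow> inner (fst z0) v + inner y (snd z0) - inner y v + (norm z0)\<^sup>2 / 2"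
      by (intro tendsto_intros lim) auto
    ultimately show "inner (fst z0) v + inner y (snd z0) - inner y v + (norm z0)\<^sup>2 / 2 \<le> m"
      using z yv LIMSEQ_le[of _ _ _ "m + 0"] by (force simp: Q_def)
  qed
  have optimal: "(norm (z0 - w))\<^sup>2 / 2 \<le> r - m" if "Q r w" for r w
  proof -
    let ?c = "(norm (z0 - w))\<^sup>2 / 2"
    \<comment> \<open>Compare \<open>m\<close> with the value a fraction \<open>t\<close> of the way
      from \<open>z0\<close> to \<open>w\<close> and divide by \<open>t\<close>; letting
      \<open>t\<close> tend to 0 then removes the factor \<open>1 - t\<close>.\<close>
    have "(1 - t) * ?c \<le> r - m" if t: "0 < t" "t \<le> 1" for t
    proof -
      have "0 \<le> t * (r - m - (1 - t) * ?c)"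
        using m_le[OF Q_convex[OF Qm \<open>Q r w\<close>, of t]] t by (simp add: algebra_simps)
      then show ?thesis
        using t by (simp add: zero_le_mult_iff)
    qed
    then have ev: "eventually (\<lambda>t. (1 - t) * ?c \<le> r - m) (at_right 0)"
      using eventually_at_right_less[of "0::real"] eventually_at_right_real[of 0 1]
      by (auto elim: eventually_mono)
    have "((\<lambda>t. (1 - t) * ?c) \<longlongrightarrow> (1 - 0) * ?c) (at_right 0)"
      by (intro tendsto_intros)
    from tendsto_upperbound[OF this ev] show ?thesis
      by simp
  qed
  obtain x u where z0: "z0 = (x, u)" by force
  \<comment> \<open>The competitors are graph points, where by \<open>Q_graph\<close> the minimized
    function is controlled by the duality product.\<close>
  have key: "inner (y + u) (v + x) \<ge> m + (norm (x + u))\<^sup>2 / 2" if "v \<in> A y" for y v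
  proof -
    have "(norm (z0 - (y, v)))\<^sup>2 = (norm z0)\<^sup>2 + (norm (y, v))\<^sup>2 - 2 * (inner x y + inner u v)"
      unfolding power2_norm_eq_inner z0
      by (simp add: inner_prod_def inner_diff_left inner_diff_right inner_commute)
    moreover have "(norm (x + u))\<^sup>2 = (norm z0)\<^sup>2 + 2 * inner x u"
      unfolding power2_norm_eq_inner z0
      by (simp add: inner_prod_def inner_add_left inner_add_right inner_commute)
    moreover have "inner (y + u) (v + x) = inner y v + inner x y + inner u v + inner x u"
      by (simp add: inner_add_left inner_add_right inner_commute)
    ultimately show ?thesis
      using optimal[OF Q_graph[OF that]] by argo
  qed
  have "- x \<in> A (- u)"
  proof (rule max)
    fix y v assume "v \<in> A y"
    have "inner (- u - y) (- x - v) = inner (y + u) (v + x)"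
      by (simp add: inner_add_left inner_add_right inner_diff_left inner_diff_right)
    then show "0 \<le> inner (- u - y) (- x - v)"
      using key[OF \<open>v \<in> A y\<close>] m_nonneg zero_le_power2[of "norm (x + u)"] by linarith
  qed
  \<comment> \<open>Testing \<open>key\<close> at the graph point \<open>(- u, - x)\<close> just
    found makes its left side vanish.\<close>
  moreover have "(norm (x + u))\<^sup>2 \<le> 0"
    using key[OF \<open>- x \<in> A (- u)\<close>] m_nonneg unfolding left_minus inner_zero_left by linarith
  then have "x + u = 0" by simp
  then have "u = - x" by (simp add: add_eq_0_iff)
  ultimately show ?thesis by auto
qed

text \<open>Translation and scaling reduce this to \<open>minty_zero\<close>:
  \<open>- y = \<beta> *\<^sub>R u\<close> with \<open>u \<in> A (y + x)\<close> says that
  \<open>y + x\<close> is the required point.\<close>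

lemma minty:
  fixes A :: "'a::{real_inner, complete_space} \<Rightarrow> 'a set"
  assumes A: "maximal_monotone A" and \<beta>: "\<beta> > 0"
  shows "\<exists>y. \<exists>u \<in> A y. x = y + \<beta> *\<^sub>R u"
proof -
  define B where "B y = (*\<^sub>R) \<beta> ` A (y + x)" for y
  have "\<exists>y. - y \<in> B y"
  proof (rule minty_zero)
    fix y z u v assume "u \<in> B y" "v \<in> B z"
    then obtain u' v' where uv: "u = \<beta> *\<^sub>R u'" "v = \<beta> *\<^sub>R v'" "u' \<in> A (y + x)" "v' \<in> A (z + x)"
      by (auto simp: B_def)
    have "inner (y - z) (u - v) = \<beta> * inner (y + x - (z + x)) (u' - v')"
      by (simp add: uv inner_diff_right algebra_simps)
    then show "0 \<le> inner (y - z) (u - v)"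
      using maximal_monotoneD_monotone[OF A uv(3,4)] \<beta> by simp
  next
    fix y u assume rel: "\<And>z v. v \<in> B z \<Longrightarrow> 0 \<le> inner (y - z) (u - v)"
    have "inverse \<beta> *\<^sub>R u \<in> A (y + x)"
    proof (rule maximal_monotone_memI[OF A])
      fix z v assume "v \<in> A z"
      then have "0 \<le> inner (y - (z - x)) (u - \<beta> *\<^sub>R v)"
        by (intro rel) (auto simp: B_def)
      also have "\<dots> = inner (y + x - z) (\<beta> *\<^sub>R (inverse \<beta> *\<^sub>R u - v))"
        using \<beta> by (simp add: algebra_simps)
      finally show "0 \<le> inner (y + x - z) (inverse \<beta> *\<^sub>R u - v)"
        using \<beta> by (simp add: zero_le_mult_iff)
    qed
    then show "u \<in> B y"
      using \<beta> by (force simp: B_def image_iff)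
  qed
  then obtain y u where "u \<in> A (y + x)" "- y = \<beta> *\<^sub>R u"
    by (auto simp: B_def)
  then have "x = (y + x) + \<beta> *\<^sub>R u"
    by (metis add.commute add_uminus_conv_diff add_diff_cancel_left')
  with \<open>u \<in> A (y + x)\<close> show ?thesis by blast
qed

section \<open>Uniqueness and basic estimates for resolvents\<close>

lemma resolvent_eqI:
  assumes A: "maximal_monotone A" and \<beta>: "\<beta> > 0" and u: "u \<in> A y" "x = y + \<beta> *\<^sub>R u"
  shows "resolvent A \<beta> x = y"
  unfolding resolvent_def
proof (rule the_equality)
  show "\<exists>u\<in>A y. x = y + \<beta> *\<^sub>R u" using u by blast
next
  fix z assume "\<exists>u\<in>A z. x = z + \<beta> *\<^sub>R u"
  then obtain v where v: "v \<in> A z" "x = z + \<beta> *\<^sub>R v" by blast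
  \<comment> \<open>Two candidates give opposite directions \<open>y - z\<close> and
    \<open>u - v\<close>, which monotonicity permits only if both vanish.\<close>
  have yz: "y - z = \<beta> *\<^sub>R (v - u)"
    using u v by (simp add: algebra_simps)
  have "0 \<le> inner (y - z) (u - v)"
    using maximal_monotoneD_monotone[OF A u(1) v(1)] .
  also have "inner (y - z) (u - v) = - (\<beta> * (norm (v - u))\<^sup>2)"
    unfolding yz power2_norm_eq_inner by (simp add: inner_diff_left inner_diff_right inner_commute algebra_simps)
  finally have "(norm (v - u))\<^sup>2 \<le> 0"
    using \<beta> by (simp add: mult_le_0_iff)
  then show "z = y"
    using yz by simp
qed

lemma resolvent_mem:
  fixes A :: "'a::{real_inner, complete_space} \<Rightarrow> 'a set"
  assumes A: "maximal_monotone A" and \<beta>: "\<beta> > 0"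
  shows "inverse \<beta> *\<^sub>R (x - resolvent A \<beta> x) \<in> A (resolvent A \<beta> x)"
proof -
  obtain y u where u: "u \<in> A y" "x = y + \<beta> *\<^sub>R u"
    using minty[OF A \<beta>] by blast
  have "resolvent A \<beta> x = y"
    using resolvent_eqI[OF A \<beta> u] .
  then show ?thesis
    using u \<beta> by simp
qed

text \<open>Firm nonexpansiveness: monotonicity at the two images bounds
  \<open>norm d * norm d\<close> by \<open>inner d (x - y)\<close>, and Cauchy-Schwarz
  finishes.\<close>

lemma resolvent_nonexpansive:
  fixes A :: "'a::{real_inner, complete_space} \<Rightarrow> 'a set"
  assumes A: "maximal_monotone A" and \<beta>: "\<beta> > 0"
  shows "norm (resolvent A \<beta> x - resolvent A \<beta> y) \<le> norm (x - y)"
proof -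
  define d where "d = resolvent A \<beta> x - resolvent A \<beta> y"
  have "0 \<le> inner d (inverse \<beta> *\<^sub>R (x - resolvent A \<beta> x) - inverse \<beta> *\<^sub>R (y - resolvent A \<beta> y))"
    unfolding d_def by (intro maximal_monotoneD_monotone[OF A] resolvent_mem[OF A \<beta>])
  also have "\<dots> = inverse \<beta> * inner d (x - y - d)"
    by (simp add: d_def inner_diff_right algebra_simps)
  finally have "0 \<le> inner d (x - y - d)"
    using \<beta> by (simp add: zero_le_mult_iff)
  then have "norm d * norm d \<le> inner d (x - y)"
    by (simp add: inner_diff_right flip: power2_norm_eq_inner power2_eq_square)
  also have "\<dots> \<le> norm d * norm (x - y)"
    by (rule norm_cauchy_schwarz)
  finally show ?thesis
    by (fold d_def) (cases "d = 0"; simp)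
qed

lemma resolvent_zero:
  assumes "maximal_monotone A" "\<beta> > 0" "p \<in> zeros_op A"
  shows "resolvent A \<beta> p = p"
  using assms by (intro resolvent_eqI[where u = 0]) (auto simp: zeros_op_def)

text \<open>The displacement \<open>d\<close> is itself a value of \<open>A\<close> at the resolvent
  point, so monotonicity against \<open>u\<close> gives \<open>0 \<le> inner d (u - d)\<close>. This
  turns small operator values into approximate fixed points.\<close>

lemma resolvent_one_displacement:
  fixes A :: "'a::{real_inner, complete_space} \<Rightarrow> 'a set"
  assumes A: "maximal_monotone A" and u: "u \<in> A y"
  shows "norm (resolvent A 1 y - y) \<le> norm u"
proof -
  define d where "d = y - resolvent A 1 y"
  have "d \<in> A (resolvent A 1 y)"
    using resolvent_mem[OF A, of 1 y] by (simp add: d_def)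
  then have "0 \<le> inner d (u - d)"
    using maximal_monotoneD_monotone[OF A u] by (simp add: d_def)
  then have "norm d * norm d \<le> inner d u"
    by (simp add: inner_diff_right flip: power2_norm_eq_inner power2_eq_square)
  also have "\<dots> \<le> norm d * norm u"
    by (rule norm_cauchy_schwarz)
  finally have "norm d \<le> norm u"
    by (cases "d = 0"; simp)
  then show ?thesis
    by (simp add: d_def norm_minus_commute)
qed

text \<open>With \<open>c\<close>, \<open>d\<close> the displacements for parameters 1 and \<beta>,
  monotonicity and Cauchy-Schwarz give
  \<open>(norm d - norm c) * (norm d - \<beta> * norm c) \<le> 0\<close>, so \<open>norm d\<close>
  lies between \<open>norm c\<close> and \<open>\<beta> * norm c\<close>.\<close>

lemma resolvent_displacement_le:
  fixes A :: "'a::{real_inner, complete_space} \<Rightarrow> 'a set"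
  assumes A: "maximal_monotone A" and \<beta>: "\<beta> > 0"
  shows "norm (x - resolvent A \<beta> x) \<le> max 1 \<beta> * norm (x - resolvent A 1 x)"
proof (rule ccontr)
  define c where "c = x - resolvent A 1 x"
  define d where "d = x - resolvent A \<beta> x"
  assume "\<not> ?thesis"
  then have less: "max 1 \<beta> * norm c < norm d"
    by (simp add: c_def d_def)
  have "norm c * 1 \<le> norm c * max 1 \<beta>" "norm c * \<beta> \<le> norm c * max 1 \<beta>"
    by (intro mult_left_mono; simp)+
  with less have "norm c < norm d" "\<beta> * norm c < norm d"
    by (simp_all add: mult.commute)
  then have "0 < (norm d - norm c) * (norm d - \<beta> * norm c)"
    by simp
  have "resolvent A \<beta> x - resolvent A 1 x = c - d"
    by (simp add: c_def d_def)
  moreover have "0 \<le> inner (resolvent A \<beta> x - resolvent A 1 x) (inverse \<beta> *\<^sub>R d - c)"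
    using resolvent_mem[OF A \<beta>, of x] resolvent_mem[OF A, of 1 x]
    by (intro maximal_monotoneD_monotone[OF A]) (simp_all add: c_def d_def)
  ultimately have "0 \<le> \<beta> * inner (c - d) (inverse \<beta> *\<^sub>R d - c)"
    using \<beta> by simp
  also have "\<dots> = (1 + \<beta>) * inner c d - \<beta> * (norm c)\<^sup>2 - (norm d)\<^sup>2"
    unfolding power2_norm_eq_inner using \<beta>
    by (simp add: inner_diff_left inner_diff_right inner_commute field_simps)
  also have "\<dots> \<le> (1 + \<beta>) * (norm c * norm d) - \<beta> * (norm c)\<^sup>2 - (norm d)\<^sup>2"
    using \<beta> by (simp add: norm_cauchy_schwarz)
  also have "\<dots> = - ((norm d - norm c) * (norm d - \<beta> * norm c))"
    by (simp add: algebra_simps power2_eq_square)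
  finally show False
    using \<open>0 < (norm d - norm c) * (norm d - \<beta> * norm c)\<close> by linarith
qed

section \<open>Approximate metric projections\<close>

text \<open>Quantitative form of the convexity of fixed point sets. The image of the combination is
  almost as close to \<open>x\<close> and \<open>y\<close> as the combination itself; in the convex
  combination identity the terms free of \<delta> cancel.\<close>

lemma approx_fixed_point_convex_combination:
  fixes T :: "'a::real_inner \<Rightarrow> 'a"
  assumes T: "\<And>x y. norm (T x - T y) \<le> norm (x - y)"
    and t: "0 \<le> t" "t \<le> 1"
    and x: "norm (T x - x) \<le> \<delta>" and y: "norm (T y - y) \<le> \<delta>" and xy: "norm (x - y) \<le> d"
  shows "(norm (T ((1 - t) *\<^sub>R x + t *\<^sub>R y) - ((1 - t) *\<^sub>R x + t *\<^sub>R y)))\<^sup>2 \<le> d * \<delta> + \<delta>\<^sup>2"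
proof -
  define z where "z = (1 - t) *\<^sub>R x + t *\<^sub>R y"
  define r where "r = norm (x - y)"
  have \<delta>: "0 \<le> \<delta>" using x norm_ge_zero order_trans by blast
  have r: "0 \<le> r" "r \<le> d" using xy by (auto simp: r_def)
  have "z - x = t *\<^sub>R (y - x)" "z - y = (1 - t) *\<^sub>R (x - y)"
    by (simp_all add: z_def algebra_simps)
  then have zx: "norm (z - x) = t * r" and zy: "norm (z - y) = (1 - t) * r"
    using t by (simp_all add: r_def norm_minus_commute)
  have "norm (T z - x) \<le> t * r + \<delta>"
    using norm_triangle_ineq[of "T z - T x" "T x - x"] T[of z x] x zx by simp
  then have sx: "(norm (T z - x))\<^sup>2 \<le> (t * r + \<delta>)\<^sup>2"
    by (rule power_mono) simp
  have "norm (T z - y) \<le> (1 - t) * r + \<delta>"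
    using norm_triangle_ineq[of "T z - T y" "T y - y"] T[of z y] y zy by simp
  then have sy: "(norm (T z - y))\<^sup>2 \<le> ((1 - t) * r + \<delta>)\<^sup>2"
    by (rule power_mono) simp
  have Tz: "T z - z = (1 - t) *\<^sub>R (T z - x) + t *\<^sub>R (T z - y)"
    by (simp add: z_def algebra_simps)
  have "(norm (T z - z))\<^sup>2
      = (1 - t) * (norm (T z - x))\<^sup>2 + t * (norm (T z - y))\<^sup>2 - t * (1 - t) * r\<^sup>2"
    unfolding Tz norm_convex_combination_sq by (simp add: r_def norm_minus_commute)
  also have "\<dots> \<le> (1 - t) * (t * r + \<delta>)\<^sup>2 + t * ((1 - t) * r + \<delta>)\<^sup>2 - t * (1 - t) * r\<^sup>2"
    using sx sy t by (intro diff_mono add_mono mult_left_mono) auto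
  also have "\<dots> = 4 * (t * (1 - t)) * (r * \<delta>) + \<delta>\<^sup>2"
    by (simp add: power2_eq_square algebra_simps)
  also have "\<dots> \<le> 1 * (d * \<delta>) + \<delta>\<^sup>2"
  proof -
    have "4 * (t * (1 - t)) \<le> 1"
      using zero_le_power2[of "2 * t - 1"] by (simp add: power2_eq_square algebra_simps)
    moreover have "r * \<delta> \<le> d * \<delta>"
      using r \<delta> by (intro mult_right_mono)
    ultimately have "4 * (t * (1 - t)) * (r * \<delta>) \<le> 1 * (d * \<delta>)"
      using r \<delta> by (intro mult_mono) auto
    then show ?thesis by simp
  qed
  finally show ?thesis
    by (simp add: z_def)
qed

lemma w_rate_ge:
  assumes "0 < N"
  shows "m \<le> w_rate v N m"
proof -
  have "m \<le> (m + 1)\<^sup>2" by (simp add: power2_eq_square)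
  also have "\<dots> \<le> 24 * N * (m + 1)\<^sup>2" using assms by simp
  finally show ?thesis by (simp add: w_rate_def)
qed

lemma w_rate_funpow_mono:
  assumes "0 < N" "i \<le> j"
  shows "(w_rate v N ^^ i) m \<le> (w_rate v N ^^ j) m"
  using assms(2)
  by (induction rule: dec_induct) (auto intro: order_trans[OF _ w_rate_ge[OF assms(1)]])

text \<open>If no pair \<open>(n, z)\<close> works, an approximate fixed point \<open>z\<close> can be moved towards a witness \<open>y\<close> of
  failure by the fraction \<open>t = 1 / (4 N\<^sup>2 (k + 1))\<close>. This lowers \<open>\<parallel>z - x0\<parallel>\<^sup>2 < N\<^sup>2\<close> by at least
  \<open>1 / (4 N\<^sup>2 (k + 1)\<^sup>2)\<close> while only degrading the fixed point error as prescribed by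
  \<open>w_rate\<close>, which is impossible \<open>4 N\<^sup>4 (k + 1)\<^sup>2\<close> times in a row.\<close>

lemma quantitative_projection:
  fixes T :: "'a::real_inner \<Rightarrow> 'a" and N k :: nat and v :: "nat \<Rightarrow> nat"
  assumes T: "\<And>x y. norm (T x - T y) \<le> norm (x - y)"
    and Tp: "T p = p" and x0: "norm (x0 - p) < N"
  shows "\<exists>n \<le> 24 * N * ((w_rate v N ^^ (4 * N ^ 4 * (k + 1)\<^sup>2)) 0 + 1)\<^sup>2. \<exists>z.
    norm (z - p) \<le> N \<and> norm (T z - z) \<le> 1 / (real (v n) + 1) \<and>
    (\<forall>y. norm (y - p) \<le> N \<longrightarrow> norm (T y - y) \<le> 1 / (real n + 1) \<longrightarrow>
      inner (x0 - z) (y - z) \<le> 1 / (real k + 1))"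
proof (rule ccontr)
  define w where "w = w_rate v N"
  define R where "R = 4 * N ^ 4 * (k + 1)\<^sup>2"
  define \<epsilon> where "\<epsilon> = 1 / (4 * (real N)\<^sup>2 * (real k + 1)\<^sup>2)"
  define t where "t = 1 / (4 * (real N)\<^sup>2 * (real k + 1))"
  assume neg: "\<not> ?thesis"
  have N: "0 < N"
    using x0 norm_ge_zero[of "x0 - p"] by linarith
  have t: "0 \<le> t" "t \<le> 1"
    using N by (auto simp: t_def divide_le_eq mult_ge1_I)
  \<comment> \<open>The precision runs backwards through the iterates of \<open>w\<close>: the exact
    fixed point \<open>p\<close> meets the strictest demand, and each descent step spends one
    application of \<open>w\<close>.\<close>
  have "\<exists>z. norm (z - p) \<le> N \<and> norm (T z - z) \<le> 1 / (real ((w ^^ (R - i)) 0) + 1)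
      \<and> (norm (z - x0))\<^sup>2 < (real N)\<^sup>2 - real i * \<epsilon>" if "i \<le> R" for i
    using that
  proof (induction i)
    case 0
    show ?case
      using x0 Tp by (intro exI[of _ p]) (auto simp: norm_minus_commute intro: power_strict_mono)
  next
    case (Suc i)
    define m where "m = (w ^^ (R - Suc i)) 0"
    define n where "n = 24 * N * (m + 1)\<^sup>2"
    define \<delta> where "\<delta> = 1 / (real n + 1)"
    have \<delta>: "0 \<le> \<delta>" by (simp add: \<delta>_def)
    have "R - i = Suc (R - Suc i)"
      using Suc.prems by simp
    then have wm: "(w ^^ (R - i)) 0 = w m"
      by (simp add: m_def)
    obtain z where z: "norm (z - p) \<le> N" "norm (T z - z) \<le> 1 / (real (w m) + 1)"
        "(norm (z - x0))\<^sup>2 < (real N)\<^sup>2 - real i * \<epsilon>"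
      using Suc unfolding wm by auto
    \<comment> \<open>\<open>w m\<close> dominates both \<open>v n\<close>, so that
      \<open>neg\<close> applies to \<open>z\<close> and yields a \<open>y\<close>, and
      \<open>n\<close>, so that \<open>z\<close> is as precise as that \<open>y\<close>.\<close>
    have "v n \<le> w m" "n \<le> w m"
      by (simp_all add: w_def w_rate_def n_def)
    then have "1 / (real (w m) + 1) \<le> 1 / (real (v n) + 1)" "1 / (real (w m) + 1) \<le> \<delta>"
      by (simp_all add: \<delta>_def frac_le)
    with z have zv: "norm (T z - z) \<le> 1 / (real (v n) + 1)" and z\<delta>: "norm (T z - z) \<le> \<delta>"
      by linarith+
    have "m \<le> (w ^^ R) 0"
      unfolding m_def w_def by (rule w_rate_funpow_mono[OF N]) simp
    then have "n \<le> 24 * N * ((w ^^ R) 0 + 1)\<^sup>2"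
      unfolding n_def by (intro mult_left_mono power_mono) auto
    then obtain y where y: "norm (y - p) \<le> N" "norm (T y - y) \<le> \<delta>"
        "1 / (real k + 1) < inner (x0 - z) (y - z)"
      using neg z(1) zv unfolding \<delta>_def w_def R_def by force
    define z' where "z' = (1 - t) *\<^sub>R z + t *\<^sub>R y"
    have zy: "norm (z - y) \<le> 2 * real N"
      using norm_triangle_ineq4[of "z - p" "y - p"] z(1) y(1) by simp
    have "norm (T z' - z') \<le> 1 / (real m + 1)"
    proof (rule power2_le_imp_le)
      have "(norm (T z' - z'))\<^sup>2 \<le> 2 * real N * \<delta> + \<delta>\<^sup>2"
        unfolding z'_def by (rule approx_fixed_point_convex_combination[OF T t z\<delta> y(2) zy])
      also have "\<dots> \<le> 3 * real N * \<delta>"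
      proof -
        have "\<delta> \<le> 1" "1 \<le> real N"
          using N by (simp_all add: \<delta>_def)
        then have "\<delta> * \<delta> \<le> real N * \<delta>"
          using \<delta> by (intro mult_right_mono) auto
        then show ?thesis by (simp add: power2_eq_square mult.commute)
      qed
      also have "\<dots> \<le> (1 / (real m + 1))\<^sup>2"
      proof -
        \<comment> \<open>The factor 24 in \<open>w_rate\<close> more than covers the 3 needed
          here.\<close>
        have "3 * real N * (real m + 1)\<^sup>2 \<le> real n + 1"
          by (simp add: n_def add.commute add_increasing mult_right_mono)
        then show ?thesis
          by (simp add: \<delta>_def power_one_over divide_le_eq le_divide_eq)
      qed
      finally show "(norm (T z' - z'))\<^sup>2 \<le> (1 / (real m + 1))\<^sup>2" .
    qed simp
    moreover have "norm (z' - p) \<le> N"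
    proof -
      have "z' - p = (1 - t) *\<^sub>R (z - p) + t *\<^sub>R (y - p)"
        by (simp add: z'_def algebra_simps)
      then have "norm (z' - p) \<le> (1 - t) * norm (z - p) + t * norm (y - p)"
        using norm_triangle_ineq[of "(1 - t) *\<^sub>R (z - p)" "t *\<^sub>R (y - p)"] t by simp
      also have "\<dots> \<le> N"
        using z(1) y(1) t by (intro convex_bound_le) auto
      finally show ?thesis .
    qed
    moreover have "(norm (z' - x0))\<^sup>2 < (real N)\<^sup>2 - real (Suc i) * \<epsilon>"
    proof -
      have diff: "z' - x0 = (z - x0) + t *\<^sub>R (y - z)"
        by (simp add: z'_def algebra_simps)
      have "(norm (z' - x0))\<^sup>2
          = (norm (z - x0))\<^sup>2 - 2 * t * inner (x0 - z) (y - z) + t\<^sup>2 * (norm (z - y))\<^sup>2"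
        unfolding diff power2_norm_eq_inner
        by (simp add: power2_eq_square inner_add_left inner_add_right inner_diff_left inner_diff_right inner_commute algebra_simps)
      also have "\<dots> \<le> (norm (z - x0))\<^sup>2 - 2 * t * (1 / (real k + 1)) + t\<^sup>2 * (2 * real N)\<^sup>2"
        using y(3) zy t by (intro add_mono diff_mono mult_left_mono power_mono) auto
      \<comment> \<open>The linear gain is twice the quadratic loss, since \<open>t\<close>
        minimizes \<open>4 * N^2 * t^2 - 2 * t / (k + 1)\<close>.\<close>
      also have "2 * t * (1 / (real k + 1)) = 2 * \<epsilon>"
        by (simp add: t_def \<epsilon>_def power2_eq_square)
      also have "t\<^sup>2 * (2 * real N)\<^sup>2 = \<epsilon>"
        using N by (simp add: t_def \<epsilon>_def power2_eq_square)
      finally show ?thesis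
        using z(3) by (simp add: algebra_simps)
    qed
    ultimately show ?case
      unfolding m_def by blast
  qed
  from this[of R] obtain z where z: "(norm (z - x0))\<^sup>2 < (real N)\<^sup>2 - real R * \<epsilon>"
    by auto
  \<comment> \<open>\<open>R\<close> is the number of descents of size \<epsilon> that exhausts the
    initial bound, leaving a square below 0.\<close>
  have "real R * \<epsilon> = (real N)\<^sup>2"
  proof -
    have "real R = (real N)\<^sup>2 * (4 * (real N)\<^sup>2 * (real k + 1)\<^sup>2)"
      by (simp add: R_def power2_eq_square power4_eq_xxxx algebra_simps)
    moreover have "real k + 1 \<noteq> 0"
      by linarith
    ultimately show ?thesis
      using N by (simp add: \<epsilon>_def)
  qed
  with z show False
    using zero_le_power2[of "norm (z - x0)"] by linarith
qed

section \<open>A quantitative Xu lemma\<close>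

text \<open>The level \<rho> is reproduced by its weights \<open>1 - \<alpha> i\<close> and
  \<open>\<alpha> i\<close>, the starting value is damped by the product, and the perturbations
  \<open>c i\<close> are simply summed, bounding their damping by 1.\<close>

lemma halpern_recursion_bound:
  fixes s \<alpha> c :: "nat \<Rightarrow> real"
  assumes step: "\<And>i. m \<le> i \<Longrightarrow> i < n \<Longrightarrow> s (Suc i) \<le> (1 - \<alpha> i) * (s i + c i) + \<alpha> i * \<rho>"
    and \<alpha>: "\<And>i. 0 \<le> \<alpha> i" "\<And>i. \<alpha> i \<le> 1" and c: "\<And>i. 0 \<le> c i" and \<rho>: "0 \<le> \<rho>"
    and start: "s m \<le> K" and mn: "m \<le> n"
  shows "s n \<le> (\<Prod>i\<in>{m..<n}. 1 - \<alpha> i) * K + \<rho> + (\<Sum>i\<in>{m..<n}. c i)"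
  using mn step
proof (induction rule: dec_induct)
  case base
  then show ?case using start \<rho> by simp
next
  case (step i)
  let ?P = "\<Prod>i\<in>{m..<i}. 1 - \<alpha> i" and ?C = "\<Sum>i\<in>{m..<i}. c i"
  have "0 \<le> ?C" using c by (simp add: sum_nonneg)
  have "s (Suc i) \<le> (1 - \<alpha> i) * (s i + c i) + \<alpha> i * \<rho>"
    using step by auto
  also have "\<dots> \<le> (1 - \<alpha> i) * (?P * K + \<rho> + ?C + c i) + \<alpha> i * \<rho>"
    using step \<alpha>[of i] by (intro add_mono mult_left_mono) auto
  also have "\<dots> = ((1 - \<alpha> i) * ?P) * K + \<rho> + (1 - \<alpha> i) * (?C + c i)"
    by (simp add: algebra_simps)
  also have "(1 - \<alpha> i) * (?C + c i) \<le> 1 * (?C + c i)"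
    using \<alpha>[of i] c[of i] \<open>0 \<le> ?C\<close> by (intro mult_right_mono) auto
  finally show ?case
    using step by (simp add: mult.commute)
qed

section \<open>The Halpern-type proximal point algorithm\<close>

locale hppa =
  fixes A :: "'a::{real_inner, complete_space} \<Rightarrow> 'a set"
    and \<alpha> \<beta> :: "nat \<Rightarrow> real" and e x :: "nat \<Rightarrow> 'a"
    and a b B E :: "nat \<Rightarrow> nat" and D Ec :: nat and p :: 'a
  assumes maxmono: "maximal_monotone A"
    and alpha_range: "\<And>n. 0 < \<alpha> n \<and> \<alpha> n < 1"
    and beta_pos: "\<And>n. \<beta> n > 0"
    and HPPA: "\<And>n. x (Suc n) = \<alpha> n *\<^sub>R x 0 + (1 - \<alpha> n) *\<^sub>R (resolvent A (\<beta> n) (x n) + e n)"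
    and mono_a: "mono a" and mono_b: "mono b" and mono_B: "mono B" and mono_E: "mono E"
    and Q1: "\<And>k n. n \<ge> a k \<Longrightarrow> \<alpha> n \<le> 1 / (real k + 1)"
    and Q3': "\<And>n. \<beta> n \<le> real (b n)"
    and Q3: "\<And>k n. n \<ge> B k \<Longrightarrow> \<beta> n \<ge> real k"
    and Q4: "\<And>k n. (\<Sum>i\<in>{E k + 1..E k + n}. norm (e i)) \<le> 1 / (real k + 1)"
    and Ec_bound: "real Ec \<ge> 1 + (\<Sum>i\<in>{0..E 0}. norm (e i))"
    and p_S: "p \<in> zeros_op A"
    and D_bound: "real D \<ge> norm (x 0 - p)"
begin

section \<open>Error sums, boundedness and asymptotic regularity of the iterates\<close>

lemma Ec_pos: "1 \<le> Ec"
proof -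
  have "0 \<le> (\<Sum>i\<in>{0..E 0}. norm (e i))" by (simp add: sum_nonneg)
  then show ?thesis using Ec_bound by linarith
qed

lemma error_tail:
  assumes "E k < m"
  shows "(\<Sum>i\<in>{m..<n}. norm (e i)) \<le> 1 / (real k + 1)"
proof -
  have "(\<Sum>i\<in>{m..<n}. norm (e i)) \<le> (\<Sum>i\<in>{E k + 1..E k + n}. norm (e i))"
    using assms by (intro sum_mono2) auto
  then show ?thesis using Q4[of k n] by linarith
qed

lemma error_small: "norm (e i) \<le> 1 / (real k + 1)" if "E k < i"
  using error_tail[OF that, of "Suc i"] by simp

text \<open>Split at \<open>E 0\<close>: by \<open>Q4\<close> the tail contributes at most 1, which
  is the summand 1 in \<open>Ec_bound\<close>.\<close>

lemma error_total: "(\<Sum>i<n. norm (e i)) \<le> real Ec"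
proof -
  have "(\<Sum>i<n. norm (e i)) \<le> (\<Sum>i\<in>{0..E 0} \<union> {Suc (E 0)..<n}. norm (e i))"
    by (intro sum_mono2) auto
  also have "\<dots> = (\<Sum>i\<in>{0..E 0}. norm (e i)) + (\<Sum>i\<in>{Suc (E 0)..<n}. norm (e i))"
    by (intro sum.union_disjoint) auto
  finally show ?thesis
    using error_tail[of 0 "Suc (E 0)" n] Ec_bound by simp
qed

lemma resolvent_dist_zero: "norm (resolvent A (\<beta> n) y - p) \<le> norm (y - p)"
  using resolvent_nonexpansive[OF maxmono beta_pos[of n], of y p]
  by (simp add: resolvent_zero[OF maxmono beta_pos p_S])

lemma iterates_bounded: "norm (x n - p) \<le> real D + real Ec"
proof -
  \<comment> \<open>Each iterate averages two points that stay within the previous bound plus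
    \<open>norm (e n)\<close>, so the errors only add up.\<close>
  have "norm (x n - p) \<le> real D + (\<Sum>i<n. norm (e i))"
  proof (induction n)
    case 0
    then show ?case using D_bound by simp
  next
    case (Suc n)
    let ?s = "\<Sum>i<n. norm (e i)"
    have "x (Suc n) - p = \<alpha> n *\<^sub>R (x 0 - p) + (1 - \<alpha> n) *\<^sub>R (resolvent A (\<beta> n) (x n) - p + e n)"
      by (simp add: HPPA algebra_simps)
    then have "norm (x (Suc n) - p)
        \<le> \<alpha> n * norm (x 0 - p) + (1 - \<alpha> n) * norm (resolvent A (\<beta> n) (x n) - p + e n)"
      using norm_triangle_ineq[of "\<alpha> n *\<^sub>R (x 0 - p)"
          "(1 - \<alpha> n) *\<^sub>R (resolvent A (\<beta> n) (x n) - p + e n)"] alpha_range[of n] by (simp add: less_imp_le)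
    also have "\<dots> \<le> real D + (?s + norm (e n))"
    proof (rule convex_bound_le)
      show "norm (x 0 - p) \<le> real D + (?s + norm (e n))"
        using D_bound sum_nonneg[of "{..<n}" "\<lambda>i. norm (e i)"] by (simp add: add_increasing2)
      show "norm (resolvent A (\<beta> n) (x n) - p + e n) \<le> real D + (?s + norm (e n))"
        using norm_triangle_ineq[of "resolvent A (\<beta> n) (x n) - p" "e n"]
          resolvent_dist_zero[of n "x n"] Suc.IH by linarith
    qed (use alpha_range[of n] in auto)
    finally show ?case by simp
  qed
  then show ?thesis using error_total[of n] by linarith
qed

text \<open>The difference is \<open>\<alpha> n *\<^sub>R (x 0 - ?y) + (1 - \<alpha> n) *\<^sub>R e
  n\<close>. Since \<open>2 * D + Ec\<close> bounds the distance from \<open>x 0\<close> to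
  \<open>?y\<close>, the two arguments in \<open>xi_rate\<close> give each summand half of the
  tolerance.\<close>

lemma xi_rate_spec:
  assumes "xi_rate a E D Ec k \<le> n"
  shows "norm (x (Suc n) - resolvent A (\<beta> n) (x n)) \<le> 1 / (real k + 1)"
proof -
  let ?y = "resolvent A (\<beta> n) (x n)"
  define c where "c = real (2 * D + Ec)"
  have c: "0 < c" using Ec_pos by (simp add: c_def)
  have "a (2 * (2 * D + Ec) * (k + 1) - 1) \<le> n" "E (2 * k + 1) < n"
    using assms by (auto simp: xi_rate_def)
  moreover have "real (2 * (2 * D + Ec) * (k + 1) - 1) + 1 = 2 * c * (real k + 1)"
    using Ec_pos by (simp add: c_def of_nat_diff algebra_simps)
  ultimately have \<alpha>: "\<alpha> n \<le> 1 / (2 * c * (real k + 1))" and err: "norm (e n) \<le> 1 / (2 * (real k + 1))"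
    using Q1[of "2 * (2 * D + Ec) * (k + 1) - 1" n] error_small[of "2 * k + 1" n]
    by (simp_all add: algebra_simps)
  have "norm (x 0 - ?y) \<le> norm (x 0 - p) + norm (?y - p)"
    using norm_triangle_ineq4[of "x 0 - p" "?y - p"] by simp
  also have "\<dots> \<le> c"
    using D_bound resolvent_dist_zero[of n "x n"] iterates_bounded[of n] by (simp add: c_def)
  finally have "\<alpha> n * norm (x 0 - ?y) \<le> 1 / (2 * c * (real k + 1)) * c"
    using \<alpha> alpha_range[of n] c by (intro mult_mono) auto
  also have "\<dots> = 1 / (2 * (real k + 1))"
    using c by simp
  finally have 1: "\<alpha> n * norm (x 0 - ?y) \<le> 1 / (2 * (real k + 1))" .
  have 2: "(1 - \<alpha> n) * norm (e n) \<le> 1 * norm (e n)"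
    using alpha_range[of n] by (intro mult_right_mono) auto
  have "x (Suc n) - ?y = \<alpha> n *\<^sub>R (x 0 - ?y) + (1 - \<alpha> n) *\<^sub>R e n"
    by (simp add: HPPA algebra_simps)
  then have "norm (x (Suc n) - ?y) \<le> \<alpha> n * norm (x 0 - ?y) + (1 - \<alpha> n) * norm (e n)"
    using norm_triangle_ineq[of "\<alpha> n *\<^sub>R (x 0 - ?y)" "(1 - \<alpha> n) *\<^sub>R e n"] alpha_range[of n]
    by (simp add: less_imp_le)
  also have "\<dots> \<le> 1 / (2 * (real k + 1)) + 1 / (2 * (real k + 1))"
    using 1 2 err by linarith
  also have "\<dots> = 1 / (real k + 1)"
    by (simp add: divide_simps)
  finally show ?thesis .
qed

text \<open>The resolvent point \<open>?y\<close> has the value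
  \<open>(x i - ?y) / \<beta> i\<close> of \<open>A\<close>, small because \<open>\<beta> i\<close>
  is large, and \<open>x n\<close> is near \<open>?y\<close>. The tolerance splits into a quarter, a
  half and a quarter; the final \<open>+ 1\<close> in \<open>chi1\<close> passes from
  \<open>i\<close> to \<open>n = Suc i\<close>.\<close>

lemma chi1_spec:
  assumes "chi1 a B E D Ec k \<le> n"
  shows "norm (resolvent A 1 (x n) - x n) \<le> 1 / (real k + 1)"
proof -
  define c where "c = real (D + Ec) * (real k + 1)"
  obtain i where n: "n = Suc i"
    using assms by (cases n) (auto simp: chi1_def)
  let ?y = "resolvent A (\<beta> i) (x i)"
  have "xi_rate a E D Ec (4 * k + 3) \<le> i" and B: "B (8 * (D + Ec) * (k + 1) - 1) \<le> i"
    using assms by (auto simp: chi1_def n)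
  from xi_rate_spec[OF this(1)] have xy: "norm (x n - ?y) \<le> 1 / (4 * (real k + 1))"
    by (simp add: n algebra_simps)
  have "1 * 1 \<le> c"
    unfolding c_def using Ec_pos by (intro mult_mono) auto
  then have c: "1 \<le> c" by simp
  \<comment> \<open>The subtracted 1 is harmless: \<open>8 * c - 1 \<ge> 4 * c\<close> because
    \<open>1 \<le> c\<close>.\<close>
  have "real (8 * (D + Ec) * (k + 1) - 1) = 8 * c - 1"
    using Ec_pos by (simp add: of_nat_diff c_def algebra_simps)
  with Q3[OF B] c have \<beta>: "4 * c \<le> \<beta> i" by linarith
  have "norm (resolvent A 1 ?y - ?y) \<le> norm (inverse (\<beta> i) *\<^sub>R (x i - ?y))"
    by (intro resolvent_one_displacement[OF maxmono] resolvent_mem[OF maxmono beta_pos])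
  also have "\<dots> = norm (x i - ?y) / \<beta> i"
    using beta_pos[of i] by (simp add: divide_inverse mult.commute)
  also have "\<dots> \<le> (2 * real (D + Ec)) / (4 * c)"
  proof (rule frac_le)
    show "norm (x i - ?y) \<le> 2 * real (D + Ec)"
      using norm_triangle_ineq4[of "x i - p" "?y - p"] resolvent_dist_zero[of i "x i"]
        iterates_bounded[of i] by simp
  qed (use \<beta> c in auto)
  also have "\<dots> = 1 / (2 * (real k + 1))"
    using Ec_pos by (simp add: c_def del: of_nat_add) (simp add: divide_simps)
  finally have y: "norm (resolvent A 1 ?y - ?y) \<le> 1 / (2 * (real k + 1))" .
  have "norm (resolvent A 1 (x n) - resolvent A 1 ?y) \<le> norm (x n - ?y)"
    by (rule resolvent_nonexpansive[OF maxmono]) simp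
  moreover have "norm (resolvent A 1 (x n) - x n) \<le> norm (resolvent A 1 (x n) - resolvent A 1 ?y)
      + norm (resolvent A 1 ?y - ?y) + norm (?y - x n)"
    by (rule norm_diff_triangle_le[OF norm_diff_triangle_le[OF order_refl order_refl] order_refl])
  ultimately have "norm (resolvent A 1 (x n) - x n)
      \<le> 1 / (4 * (real k + 1)) + 1 / (2 * (real k + 1)) + 1 / (4 * (real k + 1))"
    using xy y by (simp add: norm_minus_commute)
  also have "\<dots> = 1 / (real k + 1)"
    by (simp add: divide_simps) (simp add: algebra_simps)
  finally show ?thesis .
qed

lemma mono_chi1: "mono (chi1 a B E D Ec)"
  unfolding chi1_def xi_rate_def
  by (intro monoI add_mono max.mono monoD[OF mono_a] monoD[OF mono_B] monoD[OF mono_E] diff_le_mono mult_le_mono)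
    auto

text \<open>Apply \<open>quantitative_projection\<close> to the resolvent of parameter 1. From
  \<open>chi1 n\<close> on the iterates are precise enough to serve as competitors \<open>y\<close>,
  and the factor \<open>max 2 (b (u m))\<close> in \<open>nu_rate\<close> pays for passing to each
  \<open>\<beta> i\<close> with \<open>i \<le> u ?n\<close>.\<close>

lemma Psi_rate_spec:
  assumes N: "N = max (2 * D) (D + Ec)"
  shows "\<exists>n \<le> Psi_rate a b B E D Ec N k u. \<exists>z. norm (z - p) \<le> N \<and>
    (\<forall>i \<le> u n. norm (z - resolvent A (\<beta> i) z) \<le> 1 / (real (u n) + 1)) \<and>
    (\<forall>m \<ge> n. inner (x 0 - z) (x m - z) \<le> 1 / (real k + 1))"
proof -
  let ?\<chi> = "chi1 a B E D Ec"
  define v where "v = (\<lambda>m. nu_rate b u (?\<chi> m))"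
  \<comment> \<open>The strict inequality comes from \<open>Ec \<ge> 1\<close>.\<close>
  have "norm (x 0 - p) < N"
    using D_bound Ec_pos N by linarith
  then obtain n z where n: "n \<le> 24 * N * ((w_rate v N ^^ (4 * N ^ 4 * (k + 1)\<^sup>2)) 0 + 1)\<^sup>2"
    and z: "norm (z - p) \<le> N" "norm (resolvent A 1 z - z) \<le> 1 / (real (v n) + 1)"
    and proj: "\<And>y. norm (y - p) \<le> N \<Longrightarrow> norm (resolvent A 1 y - y) \<le> 1 / (real n + 1) \<Longrightarrow>
        inner (x 0 - z) (y - z) \<le> 1 / (real k + 1)"
    using quantitative_projection[where T = "resolvent A 1" and p = p and ?x0.0 = "x 0" and v = v and N = N and k = k]
      resolvent_nonexpansive[OF maxmono, of 1] resolvent_zero[OF maxmono _ p_S, of 1] by auto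
  let ?n = "?\<chi> n"
  define c where "c = max 2 (b (u ?n))"
  have c: "2 \<le> c" by (simp add: c_def)
  have v: "real (v n) + 1 = real c * (real (u ?n) + 1)"
    using c by (simp add: v_def nu_rate_def of_nat_diff algebra_simps flip: c_def)
  have "?n \<le> Psi_rate a b B E D Ec N k u"
    unfolding Psi_rate_def Let_def using monoD[OF mono_chi1 n] by (simp add: v_def)
  moreover have "norm (z - resolvent A (\<beta> i) z) \<le> 1 / (real (u ?n) + 1)" if "i \<le> u ?n" for i
  proof -
    have "b i \<le> c"
      using monoD[OF mono_b that] by (simp add: c_def)
    then have "\<beta> i \<le> real c"
      using Q3'[of i] by linarith
    then have "max 1 (\<beta> i) \<le> real c"
      using c by simp
    then have "max 1 (\<beta> i) * norm (z - resolvent A 1 z) \<le> real c * (1 / (real (v n) + 1))"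
      using z(2) by (intro mult_mono) (auto simp: norm_minus_commute)
    also have "\<dots> = 1 / (real (u ?n) + 1)"
      using c by (simp add: v)
    finally show ?thesis
      using resolvent_displacement_le[OF maxmono beta_pos[of i], of z] by linarith
  qed
  moreover have "inner (x 0 - z) (x m - z) \<le> 1 / (real k + 1)" if "?n \<le> m" for m
    using iterates_bounded[of m] chi1_spec[OF that] by (intro proj) (auto simp: N)
  ultimately show ?thesis
    using z(1) by blast
qed

text \<open>The subgradient inequality for the squared norm splits off the \<open>x 0 - z\<close>
  part. The factor \<open>1 + 4 * N\<close> arises from \<open>(r + q)^2\<close> with
  \<open>r \<le> 2 * N\<close> and \<open>q \<le> 1\<close>.\<close>

lemma step_inequality:
  assumes N: "real D + real Ec \<le> N" and z: "norm (z - p) \<le> N"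
    and \<delta>: "norm (z - resolvent A (\<beta> i) z) \<le> \<delta>" "\<delta> + norm (e i) \<le> 1"
  shows "(norm (x (Suc i) - z))\<^sup>2
    \<le> (1 - \<alpha> i) * ((norm (x i - z))\<^sup>2 + (1 + 4 * N) * (\<delta> + norm (e i)))
      + \<alpha> i * (2 * inner (x 0 - z) (x (Suc i) - z))"
proof -
  define y where "y = resolvent A (\<beta> i) (x i) + e i - z"
  define r where "r = norm (x i - z)"
  define q where "q = \<delta> + norm (e i)"
  have q: "0 \<le> q" "q \<le> 1"
    using \<delta> norm_ge_zero[of "z - resolvent A (\<beta> i) z"] norm_ge_zero[of "e i"]
    unfolding q_def by linarith+
  have r: "0 \<le> r" "r \<le> 2 * N"
    using norm_triangle_ineq4[of "x i - p" "z - p"] iterates_bounded[of i] N z by (auto simp: r_def)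
  define c where "c = resolvent A (\<beta> i) (x i) - resolvent A (\<beta> i) z"
  define d where "d = z - resolvent A (\<beta> i) z"
  have "y = c - d + e i"
    by (simp add: y_def c_def d_def)
  then have "norm y \<le> norm c + norm d + norm (e i)"
    using norm_triangle_ineq[of "c - d" "e i"] norm_triangle_ineq4[of c d] by simp
  also have "\<dots> \<le> r + q"
    using resolvent_nonexpansive[OF maxmono beta_pos[of i], of "x i" z] \<delta>(1) by (simp add: r_def q_def c_def d_def)
  finally have "(norm y)\<^sup>2 \<le> (r + q)\<^sup>2"
    by (rule power_mono) simp
  also have "\<dots> = r\<^sup>2 + 2 * r * q + q * q"
    by (simp add: power2_eq_square algebra_simps)
  also have "\<dots> \<le> r\<^sup>2 + 2 * (2 * N) * q + 1 * q"
    using r q by (intro add_mono mult_mono order_refl) auto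
  also have "\<dots> = r\<^sup>2 + (1 + 4 * N) * q"
    by (simp add: algebra_simps)
  finally have y: "(norm y)\<^sup>2 \<le> r\<^sup>2 + (1 + 4 * N) * q" .
  have x: "x (Suc i) - z = (1 - \<alpha> i) *\<^sub>R y + \<alpha> i *\<^sub>R (x 0 - z)"
    by (simp add: HPPA y_def algebra_simps)
  have sub: "(norm (c + d))\<^sup>2 \<le> (norm c)\<^sup>2 + 2 * inner d (c + d)" for c d :: 'a
    using inner_ge_zero[of d] unfolding power2_norm_eq_inner
    by (simp add: inner_add_left inner_add_right inner_commute)
  have "(norm (x (Suc i) - z))\<^sup>2 \<le> (norm ((1 - \<alpha> i) *\<^sub>R y))\<^sup>2 + 2 * inner (\<alpha> i *\<^sub>R (x 0 - z)) (x (Suc i) - z)"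
    unfolding x by (rule sub)
  also have "\<dots> = (1 - \<alpha> i) * ((1 - \<alpha> i) * (norm y)\<^sup>2) + \<alpha> i * (2 * inner (x 0 - z) (x (Suc i) - z))"
    using alpha_range[of i] by (simp add: power2_eq_square)
  also have "(1 - \<alpha> i) * ((1 - \<alpha> i) * (norm y)\<^sup>2) \<le> (1 - \<alpha> i) * (1 * (norm y)\<^sup>2)"
    using alpha_range[of i] by (intro mult_left_mono mult_right_mono) auto
  also have "\<dots> \<le> (1 - \<alpha> i) * (r\<^sup>2 + (1 + 4 * N) * q)"
    using y alpha_range[of i] by (intro mult_left_mono) auto
  finally show ?thesis
    by (simp add: r_def q_def)
qed

end

section \<open>Assembly of the metastability bound\<close>

theorem mainTheorem14:
  fixes A :: "'a::{real_inner, complete_space} \<Rightarrow> 'a set"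
    and \<alpha> \<beta> :: "nat \<Rightarrow> real" and e x :: "nat \<Rightarrow> 'a"
    and a b B E :: "nat \<Rightarrow> nat" and A' :: "nat \<Rightarrow> nat \<Rightarrow> nat"
    and D Ec :: nat and p :: 'a
  assumes maxmono: "maximal_monotone A"
    and S_ne: "zeros_op A \<noteq> {}"
    and alpha_range: "\<And>n. 0 < \<alpha> n \<and> \<alpha> n < 1"
    and beta_pos: "\<And>n. \<beta> n > 0"
    and HPPA: "\<And>n. x (Suc n) = \<alpha> n *\<^sub>R x 0 + (1 - \<alpha> n) *\<^sub>R (resolvent A (\<beta> n) (x n) + e n)"
    and mono_a: "mono a" and mono_b: "mono b" and mono_B: "mono B" and mono_E: "mono E"
    and mono_A': "\<And>m m' k k'. k \<le> k' \<Longrightarrow> m \<le> m' \<Longrightarrow> A' m k \<le> A' m' k'"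
    and Q1: "\<And>k n. n \<ge> a k \<Longrightarrow> \<alpha> n \<le> 1 / (real k + 1)"
    and Q2': "\<And>k m. (\<Prod>i\<in>{m..A' m k}. 1 - \<alpha> i) \<le> 1 / (real k + 1)"
    and Q3': "\<And>n. \<beta> n \<le> real (b n)"
    and Q3: "\<And>k n. n \<ge> B k \<Longrightarrow> \<beta> n \<ge> real k"
    and Q4: "\<And>k n. (\<Sum>i\<in>{E k + 1..E k + n}. norm (e i)) \<le> 1 / (real k + 1)"
    and Ec_bound: "real Ec \<ge> 1 + (\<Sum>i\<in>{0..E 0}. norm (e i))"
    and p_S: "p \<in> zeros_op A"
    and D_bound: "real D \<ge> norm (x 0 - p)"
  shows "\<forall>k (f :: nat \<Rightarrow> nat). mono f \<longrightarrow>
           (\<exists>n \<le> Phi2 a A' b B E D Ec k f.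
              \<forall>i\<in>{n..f n}. \<forall>j\<in>{n..f n}. norm (x i - x j) \<le> 1 / (real k + 1))"
proof (intro allI impI)
  fix k and f :: "nat \<Rightarrow> nat"
  interpret hppa A \<alpha> \<beta> e x a b B E D Ec p
    using assms by unfold_locales auto
  define K where "K = (real k + 1)\<^sup>2"
  define N where "N = max (2 * D) (D + Ec)"
  define kt where "kt = 4 * (k + 1)\<^sup>2 - 1"
  define q where "q = 16 * N\<^sup>2 * (kt + 1) - 1"
  define kE where "kE = 16 * (1 + 4 * N) * (k + 1)\<^sup>2 - 1"
  define g where "g = (\<lambda>m. max m (E kE + 1))"
  define h where "h = (\<lambda>m. (1 + 4 * N) * (16 * (k + 1)\<^sup>2 * (f (sigma2 A' N kt (g m)) + 1) + 1) - 1)"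
  have K: "1 \<le> K"
    by (simp add: K_def power2_eq_square algebra_simps)
  have N: "1 \<le> N" "real D + real Ec \<le> N"
    using Ec_pos by (auto simp: N_def)
  have kt: "real (kt + 1) = 4 * K"
    by (simp add: kt_def K_def of_nat_diff)
  have "1 * 1 \<le> (real N)\<^sup>2 * K"
    using N K by (intro mult_mono) (auto simp: one_le_power)
  then have NK: "1 \<le> (real N)\<^sup>2 * K"
    by simp
  have "0 < 16 * N\<^sup>2 * (kt + 1)"
    using N by simp
  then have "real q + 1 = real (16 * N\<^sup>2 * (kt + 1))"
    unfolding q_def by linarith
  also have "\<dots> = 64 * (real N)\<^sup>2 * K"
    unfolding of_nat_mult kt by simp
  finally have q: "real q + 1 = 64 * (real N)\<^sup>2 * K" .
  have kE: "real kE + 1 = 16 * (1 + 4 * real N) * K"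
    by (simp add: kE_def K_def of_nat_diff)
  have k32: "real (32 * (k + 1)\<^sup>2 - 1) + 1 = 32 * K"
    by (simp add: K_def of_nat_diff)
  have h: "real (h m) + 1 = (1 + 4 * real N) * (16 * K * (real (f (sigma2 A' N kt (g m))) + 1) + 1)" for m
    by (simp add: h_def K_def of_nat_diff algebra_simps)
  obtain n z where n: "n \<le> Psi_rate a b B E D Ec N (32 * (k + 1)\<^sup>2 - 1) h"
    and z: "norm (z - p) \<le> N"
    and fixed: "\<And>i. i \<le> h n \<Longrightarrow> norm (z - resolvent A (\<beta> i) z) \<le> 1 / (real (h n) + 1)"
    and proj: "\<And>m. n \<le> m \<Longrightarrow> inner (x 0 - z) (x m - z) \<le> 1 / (32 * K)"
    using Psi_rate_spec[OF N_def, of "32 * (k + 1)\<^sup>2 - 1" h] unfolding k32 by blast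
  define m where "m = g n"
  define n' where "n' = sigma2 A' N kt m"
  define F where "F = f n'"
  define \<delta> where "\<delta> = 1 / (real (h n) + 1)"
  have m: "n \<le> m" "E kE < m"
    by (auto simp: m_def g_def)
  have n': "n' = A' m q + 1"
    by (simp add: n'_def sigma2_def q_def)
  \<comment> \<open>Otherwise the product in \<open>Q2'\<close> would be empty, hence 1, which
    exceeds \<open>1 / (real q + 1)\<close>.\<close>
  have mA: "m \<le> A' m q"
  proof (rule ccontr)
    assume "\<not> ?thesis"
    then have "1 \<le> 1 / (real q + 1)"
      using Q2'[of m q] by simp
    then have "q = 0"
      by (simp add: le_divide_eq)
    then show False
      using q NK by simp
  qed
  have hn: "real (h n) + 1 = (1 + 4 * real N) * (16 * K * (real F + 1) + 1)"
    using h[of n] by (simp add: F_def n'_def m_def)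
  \<comment> \<open>\<open>h n\<close> exceeds \<open>F\<close>, so \<open>fixed\<close> covers
    every index up to \<open>F\<close>.\<close>
  have "1 * (1 * (real F + 1) + 1) \<le> (1 + 4 * real N) * (16 * K * (real F + 1) + 1)"
    using K by (intro mult_mono add_mono) auto
  then have Fh: "real F + 1 \<le> real (h n)"
    unfolding hn[symmetric] by simp
  have \<delta>_le: "\<delta> \<le> 1 / 2"
    using Fh by (simp add: \<delta>_def divide_le_eq)
  have \<delta>: "0 \<le> \<delta>" by (simp add: \<delta>_def)
  have "1 * 1 \<le> (1 + 4 * real N) * K"
    using K by (intro mult_mono) auto
  then have kE2: "2 \<le> real kE + 1"
    using kE by (simp add: algebra_simps)
  have near: "norm (x j - z) \<le> 1 / (2 * (real k + 1))" if j: "n' \<le> j" "j \<le> F" for j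
  proof -
    \<comment> \<open>The target \<open>1 / (4 * K)\<close> is split into four shares
      \<open>1 / (16 * K)\<close>: damped start, inner products, resolvent displacements and error
      tail.\<close>
    have "(norm (x j - z))\<^sup>2
        \<le> (\<Prod>i\<in>{m..<j}. 1 - \<alpha> i) * (2 * real N)\<^sup>2 + 1 / (16 * K)
          + (\<Sum>i\<in>{m..<j}. (1 + 4 * real N) * (\<delta> + norm (e i)))"
    proof (rule halpern_recursion_bound)
      fix i assume i: "m \<le> i" "i < j"
      have "norm (e i) \<le> 1 / (real kE + 1)"
        using error_small[of kE i] m i by simp
      also have "\<dots> \<le> 1 / 2"
        using kE2 by (intro divide_left_mono) auto
      finally have "\<delta> + norm (e i) \<le> 1"
        using \<delta>_le by linarith
      moreover have "norm (z - resolvent A (\<beta> i) z) \<le> \<delta>"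
        unfolding \<delta>_def using fixed i j Fh by simp
      moreover have "\<alpha> i * (2 * inner (x 0 - z) (x (Suc i) - z)) \<le> \<alpha> i * (1 / (16 * K))"
        using proj[of "Suc i"] i m alpha_range[of i] by (intro mult_left_mono) auto
      ultimately show "(norm (x (Suc i) - z))\<^sup>2
          \<le> (1 - \<alpha> i) * ((norm (x i - z))\<^sup>2 + (1 + 4 * real N) * (\<delta> + norm (e i))) + \<alpha> i * (1 / (16 * K))"
        using step_inequality[OF N(2) z, of i \<delta>] by linarith
    next
      have "norm (x m - z) \<le> 2 * real N"
        using norm_triangle_ineq4[of "x m - p" "z - p"] iterates_bounded[of m] N z by simp
      then show "(norm (x m - z))\<^sup>2 \<le> (2 * real N)\<^sup>2"
        by (rule power_mono) simp
    qed (use alpha_range \<delta> K mA n' j in \<open>auto simp: less_imp_le\<close>)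
    also have "(\<Prod>i\<in>{m..<j}. 1 - \<alpha> i) * (2 * real N)\<^sup>2 \<le> 1 / (16 * K)"
    proof -
      \<comment> \<open>Cut at \<open>n' = A' m q + 1\<close>: \<open>Q2'\<close> bounds the first
        block and the rest is at most 1. The 64 in \<open>q\<close> absorbs \<open>(2 * N)^2\<close>
        and leaves the share.\<close>
      have "(\<Prod>i\<in>{m..<j}. 1 - \<alpha> i) = (\<Prod>i\<in>{m..A' m q}. 1 - \<alpha> i) * (\<Prod>i\<in>{n'..<j}. 1 - \<alpha> i)"
        using prod.atLeastLessThan_concat[of m n' j "\<lambda>i. 1 - \<alpha> i"] mA j
        by (simp add: n' atLeastLessThanSuc_atLeastAtMost)
      also have "\<dots> \<le> 1 / (real q + 1) * 1"
        using alpha_range by (intro mult_mono Q2' prod_le_1 prod_nonneg) (auto simp: less_imp_le)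
      finally have "(\<Prod>i\<in>{m..<j}. 1 - \<alpha> i) * (2 * real N)\<^sup>2 \<le> 1 / (real q + 1) * (2 * real N)\<^sup>2"
        by (intro mult_right_mono) auto
      also have "\<dots> = 1 / (16 * K)"
        using N by (simp add: q power2_eq_square)
      finally show ?thesis .
    qed
    also have "(\<Sum>i\<in>{m..<j}. (1 + 4 * real N) * (\<delta> + norm (e i))) \<le> 1 / (16 * K) + 1 / (16 * K)"
    proof -
      have "(\<Sum>i\<in>{m..<j}. (1 + 4 * real N) * (\<delta> + norm (e i)))
          = (1 + 4 * real N) * \<delta> * real (j - m) + (1 + 4 * real N) * (\<Sum>i\<in>{m..<j}. norm (e i))"
        by (simp only: sum_distrib_left[symmetric] sum.distrib) (simp add: algebra_simps)
      also have "\<dots> \<le> (1 + 4 * real N) * \<delta> * real F + (1 + 4 * real N) * (1 / (real kE + 1))"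
        using error_tail[OF m(2), of j] \<delta> j by (intro add_mono mult_left_mono) auto
      also have "(1 + 4 * real N) * (1 / (real kE + 1)) = 1 / (16 * K)"
      proof -
        have "c * (1 / (16 * c * K)) = 1 / (16 * K)" if "c \<noteq> 0" for c
          using that by simp
        then show ?thesis
          unfolding kE by this linarith
      qed
      \<comment> \<open>At most \<open>F\<close> copies of \<delta> accumulate, which is why
        \<open>h\<close> contains the value of \<open>f\<close> at the end of the
        construction.\<close>
      also have "(1 + 4 * real N) * \<delta> * real F = real F / (16 * K * (real F + 1) + 1)"
        unfolding \<delta>_def hn by (simp add: add_nonneg_eq_0_iff)
      also have "\<dots> \<le> 1 / (16 * K)"
      proof -
        have "0 < 16 * K * (real F + 1) + 1" using K by (simp add: add_pos_nonneg)
        then show ?thesis using K by (simp add: divide_simps algebra_simps)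
      qed
      finally show ?thesis by simp
    qed
    finally have "(norm (x j - z))\<^sup>2 \<le> 4 / (16 * K)"
      by simp
    also have "\<dots> = (1 / (2 * (real k + 1)))\<^sup>2"
      by (simp add: K_def power_divide) (simp add: power2_eq_square algebra_simps)
    finally show ?thesis
      by (rule power2_le_imp_le) simp
  qed
  have "norm (x i - x j) \<le> 1 / (real k + 1)" if "i \<in> {n'..f n'}" "j \<in> {n'..f n'}" for i j
  proof -
    have "norm (x i - x j) \<le> norm (x i - z) + norm (x j - z)"
      using norm_triangle_ineq4[of "x i - z" "x j - z"] by simp
    also have "\<dots> \<le> 1 / (2 * (real k + 1)) + 1 / (2 * (real k + 1))"
      using that by (intro add_mono near) (auto simp: F_def)
    also have "\<dots> = 1 / (real k + 1)"
      by (simp add: divide_simps)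
    finally show ?thesis .
  qed
  moreover have "n' \<le> Phi2 a A' b B E D Ec k f"
  proof -
    have "Phi2 a A' b B E D Ec k f
        = sigma2 A' N kt (g (Psi_rate a b B E D Ec N (32 * (k + 1)\<^sup>2 - 1) h))"
      by (simp add: Phi2_def Let_def N_def kt_def g_def h_def kE_def)
    \<comment> \<open>The witness depends on the unknown \<open>n\<close>; monotonicity of
      \<open>g\<close> and of \<open>A'\<close> in its first argument carries the bound on
      \<open>n\<close> over to \<open>n'\<close>.\<close>
    moreover have "m \<le> g (Psi_rate a b B E D Ec N (32 * (k + 1)\<^sup>2 - 1) h)"
      using n by (auto simp: m_def g_def)
    ultimately show ?thesis
      using mono_A'[OF order_refl] by (simp add: n'_def sigma2_def)
  qed
  ultimately show "\<exists>n \<le> Phi2 a A' b B E D Ec k f.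
      \<forall>i\<in>{n..f n}. \<forall>j\<in>{n..f n}. norm (x i - x j) \<le> 1 / (real k + 1)"
    by blast
qed

end
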